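(* Let $X \subseteq \mathbb{Z}^{p_1}\times\mathbb{R}^{n_1-p_1}$ be nonempty and compact, and let $f_1,\dots,f_N:X\to\mathbb{R}$ satisfy the Complete Continuous Recourse assumption (see context). Let $v^*:=\min_{\bm{x}\in X}\sum_{i=1}^N f_i(\bm{x})$. Then the sequence of lower bounds $\{\mathit{lb}_t\}$ produced by the iterative GDD algorithm (see context) with the piecewise constant regularizers $$g_i(\mathcal{X}^t,\bm{x}) := \sum_{k=1}^{K_t} g_i^*(\bm{x}_{(k)})\,\mathbbm{1}(\bm{x}\in\mathcal{P}^t_k),\qquad i\in[N],\ t\ge1,$$ converges to $v^*$. Here $g_i^*(\bm{x}):=\frac1N\sum_{j=1}^N f_j(\bm{x})-f_i(\bm{x})$, $\mathcal{X}^t=\{\bm{x}_{(k)}:k\in[K_t]\}$ with $K_t=|\mathcal{X}^t|$, and $\{\mathcal{P}^t_k:k\in[K_t]\}$ is a Voronoi partition of $X$ with centers $\mathcal{X}^t$.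
   Context: $[N]:=\{1,\dots,N\}$; $\mathbbm{1}(\cdot)$ is the $0/1$ indicator. Voronoi partition: pairwise disjoint sets $\mathcal{P}^t_k$ with $\bigcup_{k}\mathcal{P}^t_k=X$ such that $\bm{x}\in\mathcal{P}^t_k$ only if $\|\bm{x}-\bm{x}_{(k)}\|_2\le\|\bm{x}-\bm{x}_{(j)}\|_2$ for all $j\in[K_t]$ (ties are broken arbitrarily). Iterative GDD algorithm (run without stopping). Initialize $\mathcal{X}^0=\emptyset$, $g_i(\mathcal{X}^0,\cdot)=0$ for all $i\in[N]$. In iteration $t=0,1,2,\dots$: for each $i\in[N]$, compute an optimal solution $\bm{x}^i_t$ of $\min_{\bm{x}\in X}\{f_i(\bm{x})+g_i(\mathcal{X}^t,\bm{x})\}$ (assumed to exist); set $\mathit{lb}_t := \max\{\mathit{lb}_{t-1},\ \sum_{i=1}^N (f_i(\bm{x}^i_t)+g_i(\mathcal{X}^t,\bm{x}^i_t))\}$ with $\mathit{lb}_{-1}:=-\infty$; set $\mathcal{X}^{t+1}:=\mathcal{X}^t\cup\{\bm{x}^i_t: i\in[N]\}$ and form $g_i(\mathcal{X}^{t+1},\cdot)$. Complete Continuous Recourse: for each $i\in[N]$, $f_i$ is real-valued on $X$ and given by $$f_i(\bm{x})=\min_{\bm{y},\bm{z}}\{\ell(\bm{y},\bm{z}): L(\bm{x},\bm{y},\bm{z})\le\bm{0},\ \bm{y}\in Y\cap\mathbb{Z}^{p_2},\ \bm{z}\in Z\cap\mathbb{R}^{n_2-p_2}\}$$ (the data $\ell,L,Y,Z$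 may depend on $i$), and either one of the following holds: 1. $\ell:\mathbb{R}^{n_2}\to\mathbb{R}$ and $L:\mathbb{R}^{n_1+n_2}\to\mathbb{R}^{m_2}$ are affine, $Y$ and $Z$ are polyhedral, and for all $\bm{x}\in X$ and $\bm{y}\in Y\cap\mathbb{Z}^{p_2}$ there exists $\bm{z}\in Z\cap\mathbb{R}^{n_2-p_2}$ with $L(\bm{x},\bm{y},\bm{z})\le\bm{0}$; 2. $\ell$ and $L$ are Lipschitz continuous, $L$ is (componentwise) convex in $\bm{z}$ (not necessarily in $\bm{x}$ or $\bm{y}$), $Y$ is compact, $Z$ is compact and convex, and there exists $\delta>0$ such that for all $\bm{x}\in X$ and $\bm{y}\in Y\cap\mathbb{Z}^{p_2}$ there exists $\bm{z}\in Z\cap\mathbb{R}^{n_2-p_2}$ with every component of $L(\bm{x},\bm{y},\bm{z})$ less than $-\delta$. *)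

theory Defs
  imports "HOL-Analysis.Analysis"
begin

definition is_minimum :: "real \<Rightarrow> real set \<Rightarrow> bool" where
  "is_minimum v S \<longleftrightarrow> v \<in> S \<and> (\<forall>s\<in>S. v \<le> s)"

definition affine_function :: "('a::real_vector \<Rightarrow> 'b::real_vector) \<Rightarrow> bool" where
  "affine_function h \<longleftrightarrow> (\<exists>A b. linear A \<and> h = (\<lambda>x. A x + b))"

(* Z^p x R^(n-p), where J is the set of the p integer coordinates (any subset of the n
   coordinates, so both p = 0 and p = n are allowed). *)
definition mixed_integer :: "'n set \<Rightarrow> (real ^ 'n) set" where
  "mixed_integer J = {w. \<forall>j\<in>J. w $ j \<in> \<int>}"

(* The coordinate subspace of the vectors supported on J; it serves as a copy of R^|J| that is
   also available for |J| = 0.  With p2 = |J|, a pair (y, z) in R^p2 x R^(n2-p2) is encoded as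
   y in coord_space J and z in coord_space (- J), and the joint vector in R^n2 is y + z. *)
definition coord_space :: "'n set \<Rightarrow> (real ^ 'n) set" where
  "coord_space J = {w. \<forall>j. j \<notin> J \<longrightarrow> w $ j = 0}"


definition affine_recourse ::
  "(real ^ 'n1) set \<Rightarrow> 'n2 set \<Rightarrow> (real ^ 'n2 \<Rightarrow> real) \<Rightarrow> ((real ^ 'n1) \<times> (real ^ 'n2) \<Rightarrow> real ^ 'm2)
    \<Rightarrow> (real ^ 'n2) set \<Rightarrow> (real ^ 'n2) set \<Rightarrow> bool" where
  "affine_recourse X J l L Y Z \<longleftrightarrow>
     affine_function l \<and> affine_function L \<and> polyhedron Y \<and> polyhedron Z \<and>
     (\<forall>x\<in>X. \<forall>y\<in>Y \<inter> mixed_integer J. \<exists>z\<in>Z. \<forall>r. L (x, y + z) $ r \<le> 0)"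

definition lipschitz_recourse ::
  "(real ^ 'n1) set \<Rightarrow> 'n2 set \<Rightarrow> (real ^ 'n2 \<Rightarrow> real) \<Rightarrow> ((real ^ 'n1) \<times> (real ^ 'n2) \<Rightarrow> real ^ 'm2)
    \<Rightarrow> (real ^ 'n2) set \<Rightarrow> (real ^ 'n2) set \<Rightarrow> bool" where
  "lipschitz_recourse X J l L Y Z \<longleftrightarrow>
     (\<exists>C. C-lipschitz_on UNIV l) \<and> (\<exists>C. C-lipschitz_on UNIV L) \<and>
     (\<forall>x. \<forall>y\<in>coord_space J. \<forall>r. convex_on (coord_space (- J)) (\<lambda>z. L (x, y + z) $ r)) \<and>
     compact Y \<and> compact Z \<and> convex Z \<and>
     (\<exists>\<delta>>0. \<forall>x\<in>X. \<forall>y\<in>Y \<inter> mixed_integer J. \<exists>z\<in>Z. \<forall>r. L (x, y + z) $ r < - \<delta>)"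

definition complete_continuous_recourse ::
  "(real ^ 'n1) set \<Rightarrow> 'n2 set \<Rightarrow> (real ^ 'n2 \<Rightarrow> real) \<Rightarrow> ((real ^ 'n1) \<times> (real ^ 'n2) \<Rightarrow> real ^ 'm2)
    \<Rightarrow> (real ^ 'n2) set \<Rightarrow> (real ^ 'n2) set \<Rightarrow> (real ^ 'n1 \<Rightarrow> real) \<Rightarrow> bool" where
  "complete_continuous_recourse X J l L Y Z f \<longleftrightarrow>
     Y \<subseteq> coord_space J \<and> Z \<subseteq> coord_space (- J) \<and>
     (\<forall>x\<in>X. is_minimum (f x)
        {l (y + z) | y z. (\<forall>r. L (x, y + z) $ r \<le> 0) \<and> y \<in> Y \<inter> mixed_integer J \<and> z \<in> Z}) \<and>
     (affine_recourse X J l L Y Z \<or> lipschitz_recourse X J l L Y Z)"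


(* Cells are indexed by their centers; ties may be broken arbitrarily. *)
definition voronoi_partition ::
  "'a::real_normed_vector set \<Rightarrow> 'a set \<Rightarrow> ('a \<Rightarrow> 'a set) \<Rightarrow> bool" where
  "voronoi_partition X C P \<longleftrightarrow>
     disjoint_family_on P C \<and> (\<Union>c\<in>C. P c) = X \<and>
     (\<forall>c\<in>C. \<forall>x\<in>P c. \<forall>c'\<in>C. norm (x - c) \<le> norm (x - c'))"

(* xs t i is the minimizer computed for component i in iteration t. *)
primrec centers :: "nat \<Rightarrow> (nat \<Rightarrow> nat \<Rightarrow> 'a) \<Rightarrow> nat \<Rightarrow> 'a set" where
  "centers N xs 0 = {}"
| "centers N xs (Suc t) = centers N xs t \<union> xs t ` {1..N}"

(* g t i stands for the regularizer of component i formed from the centers of iteration t. *)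
definition gdd_run ::
  "nat \<Rightarrow> 'a set \<Rightarrow> (nat \<Rightarrow> 'a \<Rightarrow> real) \<Rightarrow> (nat \<Rightarrow> nat \<Rightarrow> 'a \<Rightarrow> real) \<Rightarrow> (nat \<Rightarrow> nat \<Rightarrow> 'a) \<Rightarrow> bool" where
  "gdd_run N X f g xs \<longleftrightarrow>
     (\<forall>i\<in>{1..N}. \<forall>x\<in>X. g 0 i x = 0) \<and>
     (\<forall>t. \<forall>i\<in>{1..N}. is_arg_min (\<lambda>x. f i x + g t i x) (\<lambda>x. x \<in> X) (xs t i))"

definition gdd_value ::
  "nat \<Rightarrow> (nat \<Rightarrow> 'a \<Rightarrow> real) \<Rightarrow> (nat \<Rightarrow> nat \<Rightarrow> 'a \<Rightarrow> real) \<Rightarrow> (nat \<Rightarrow> nat \<Rightarrow> 'a) \<Rightarrow> nat \<Rightarrow> real" where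
  "gdd_value N f g xs t = (\<Sum>i=1..N. f i (xs t i) + g t i (xs t i))"

(* The recursion conventionally starts from -\<infinity> before iteration 0, so the first lower bound
   is the value of iteration 0 itself. *)
primrec gdd_lb ::
  "nat \<Rightarrow> (nat \<Rightarrow> 'a \<Rightarrow> real) \<Rightarrow> (nat \<Rightarrow> nat \<Rightarrow> 'a \<Rightarrow> real) \<Rightarrow> (nat \<Rightarrow> nat \<Rightarrow> 'a) \<Rightarrow> nat \<Rightarrow> real" where
  "gdd_lb N f g xs 0 = gdd_value N f g xs 0"
| "gdd_lb N f g xs (Suc t) = max (gdd_lb N f g xs t) (gdd_value N f g xs (Suc t))"

definition g_star :: "nat \<Rightarrow> (nat \<Rightarrow> 'a \<Rightarrow> real) \<Rightarrow> nat \<Rightarrow> 'a \<Rightarrow> real" where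
  "g_star N f i x = (1 / real N) * (\<Sum>j=1..N. f j x) - f i x"

definition pw_const_regularizer ::
  "nat \<Rightarrow> (nat \<Rightarrow> 'a \<Rightarrow> real) \<Rightarrow> 'a set \<Rightarrow> ('a \<Rightarrow> 'a set) \<Rightarrow> nat \<Rightarrow> 'a \<Rightarrow> real" where
  "pw_const_regularizer N f C P i x = (\<Sum>c\<in>C. g_star N f i c * indicator (P c) x)"

end

theory Submission
  imports Defs
begin

text \<open>
  Complete continuous recourse makes every \<open>f i\<close> Lipschitz on \<open>X\<close>: in the Lipschitz case a solution
  is repaired by moving slightly towards a Slater point, in the affine case by a Hoffman-type bound,
  which is obtained by Fourier--Motzkin elimination and is uniform in the integer part \<open>y\<close>.
  The regularizers sum to zero over \<open>i\<close>, so every iteration yields a lower bound. Since \<open>X\<close> is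
  compact, from some iteration on all minimizers lie close to earlier ones, hence to the centers of
  their cells, and there the regularized components are close to the average of the
  \<open>f j\<close>, which is at least \<open>v\<^sup>* / N\<close>.
\<close>

section \<open>Lipschitz dependence of polyhedra on the right-hand side\<close>

text \<open>A row is a pair whose right-hand side is linear in the parameter \<open>w\<close>.
  Combining rows is then plain vector arithmetic on pairs, and one set \<open>S\<close> describes
  the system for all parameters at once.\<close>

definition feasible :: "('a::euclidean_space \<times> 'b::euclidean_space) set \<Rightarrow> 'b \<Rightarrow> 'a \<Rightarrow> bool" where
  "feasible S w z \<longleftrightarrow> (\<forall>(a, b)\<in>S. a \<bullet> z \<le> b \<bullet> w)"

lemma feasibleD: "feasible S w z \<Longrightarrow> p \<in> S \<Longrightarrow> fst p \<bullet> z \<le> snd p \<bullet> w"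
  by (auto simp: feasible_def)

text \<open>One step of Fourier--Motzkin elimination; the scaling makes the \<open>e\<close>-components cancel.\<close>

definition eliminate ::
  "'a::euclidean_space \<Rightarrow> ('a \<times> 'b::euclidean_space) set \<Rightarrow> ('a \<times> 'b) set" where
  "eliminate e S = {p \<in> S. fst p \<bullet> e = 0} \<union>
     (\<lambda>(p, q). p /\<^sub>R (fst p \<bullet> e) - q /\<^sub>R (fst q \<bullet> e)) `
       ({p \<in> S. fst p \<bullet> e > 0} \<times> {q \<in> S. fst q \<bullet> e < 0})"

lemma finite_eliminate: "finite S \<Longrightarrow> finite (eliminate e S)"
  by (simp add: eliminate_def)

lemma eliminate_inner:
  assumes "p \<in> eliminate e S"
  shows "fst p \<bullet> e = 0"
  using assms by (auto simp: eliminate_def inner_diff_left)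

text \<open>New rows are combinations of old ones, so coordinates eliminated earlier stay
  eliminated.\<close>

lemma eliminate_inner_other:
  assumes "p \<in> eliminate e S" and "\<And>q. q \<in> S \<Longrightarrow> fst q \<bullet> b = 0"
  shows "fst p \<bullet> b = 0"
  using assms(1) by (auto simp: eliminate_def inner_diff_left dest!: assms(2))

text \<open>Each new row is a nonnegative combination of old rows: \<open>q\<close> enters with the
  factor \<open>- 1 / (fst q \<bullet> e)\<close>, which is positive.\<close>

lemma feasible_eliminate:
  assumes "feasible S w z"
  shows "feasible (eliminate e S) w z"
proof -
  have "(fst p /\<^sub>R (fst p \<bullet> e) - fst q /\<^sub>R (fst q \<bullet> e)) \<bullet> z
      \<le> (snd p /\<^sub>R (fst p \<bullet> e) - snd q /\<^sub>R (fst q \<bullet> e)) \<bullet> w"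
    if "p \<in> S" "q \<in> S" "fst p \<bullet> e > 0" "fst q \<bullet> e < 0" for p q
  proof -
    have "inverse (fst p \<bullet> e) * (fst p \<bullet> z) \<le> inverse (fst p \<bullet> e) * (snd p \<bullet> w)"
      using feasibleD[OF assms that(1)] that by (intro mult_left_mono) auto
    moreover have "inverse (fst q \<bullet> e) * (fst q \<bullet> z) \<ge> inverse (fst q \<bullet> e) * (snd q \<bullet> w)"
      using feasibleD[OF assms that(2)] that by (intro mult_left_mono_neg) auto
    ultimately show ?thesis by (simp add: inner_diff_left)
  qed
  moreover have "fst p \<bullet> z \<le> snd p \<bullet> w" if "p \<in> S" for p
    using feasibleD[OF assms that] .
  ultimately have "fst r \<bullet> z \<le> snd r \<bullet> w" if "r \<in> eliminate e S" for r
    using that unfolding eliminate_def by auto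
  then show ?thesis by (auto simp: feasible_def)
qed

lemma exists_between_finite:
  fixes A B :: "real set"
  assumes "finite A" "M \<ge> 0" "\<And>a b. a \<in> A \<Longrightarrow> b \<in> B \<Longrightarrow> a \<le> b"
    and "\<And>a. a \<in> A \<Longrightarrow> a \<le> M" "\<And>b. b \<in> B \<Longrightarrow> - M \<le> b"
  shows "\<exists>t. \<bar>t\<bar> \<le> M \<and> (\<forall>a\<in>A. a \<le> t) \<and> (\<forall>b\<in>B. t \<le> b)"
proof (intro exI conjI ballI)
  \<comment> \<open>Inserting \<open>- M\<close> covers empty \<open>A\<close> and bounds the choice
    from below.\<close>
  let ?t = "Max (insert (- M) A)"
  have "?t \<in> insert (- M) A" using assms(1) by (intro Max_in) auto
  moreover have "- M \<le> ?t" using assms(1) by (intro Max_ge) auto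
  ultimately show "\<bar>?t\<bar> \<le> M" using assms(2) assms(4)[of ?t] by (auto simp: abs_le_iff)
  show "a \<le> ?t" if "a \<in> A" for a using assms(1) that by (intro Max_ge) auto
  show "?t \<le> b" if "b \<in> B" for b using \<open>?t \<in> _\<close> assms(3,5) that by auto
qed

text \<open>Induction over the coordinates that the rows may involve. The hypothesis for the
  eliminated system moves \<open>z\<close> to some \<open>z1\<close>, and a further shift along
  \<open>e\<close> alone restores the rows of \<open>S\<close>. The point \<open>u\<close> only
  witnesses that the system at \<open>w'\<close> is solvable; \<open>K\<close> depends on
  \<open>S\<close> alone.\<close>

lemma feasible_lipschitz_aux:
  fixes S :: "('a::euclidean_space \<times> 'b::euclidean_space) set" and B :: "'a set"
  assumes "finite B" "B \<subseteq> Basis" "finite S"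
    and "\<And>p b. p \<in> S \<Longrightarrow> b \<in> Basis - B \<Longrightarrow> fst p \<bullet> b = 0"
  shows "\<exists>K\<ge>0. \<forall>w w' z u. feasible S w z \<longrightarrow> feasible S w' u \<longrightarrow>
           (\<exists>z'. feasible S w' z' \<and> norm (z - z') \<le> K * norm (w - w'))"
  using assms
proof (induction B arbitrary: S rule: finite_induct)
  case empty
  \<comment> \<open>With no coordinate left, feasibility does not depend on \<open>z\<close>, so
    \<open>z\<close> itself serves with \<open>K = 0\<close>.\<close>
  have "fst p = 0" if "p \<in> S" for p
    using empty(3)[OF that] by (simp add: euclidean_eq_iff[of "fst p"])
  then have "feasible S w' z" if "feasible S w' u" for w' u z
    unfolding feasible_def
  proof (clarify)
    fix a b assume "(a, b) \<in> S"
    then show "a \<bullet> z \<le> b \<bullet> w'" using feasibleD[OF that, of "(a, b)"] \<open>\<And>p. p \<in> S \<Longrightarrow> fst p = 0\<close>[of "(a, b)"] by simp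
  qed
  then show ?case by (intro exI[of _ 0]) auto
next
  case (insert e B)
  have "\<exists>K\<ge>0. \<forall>w w' z u. feasible (eliminate e S) w z \<longrightarrow> feasible (eliminate e S) w' u \<longrightarrow>
           (\<exists>z'. feasible (eliminate e S) w' z' \<and> norm (z - z') \<le> K * norm (w - w'))"
  proof (rule insert.IH)
    fix p b assume pb: "p \<in> eliminate e S" "b \<in> Basis - B"
    show "fst p \<bullet> b = 0"
    proof (cases "b = e")
      case True
      then show ?thesis using eliminate_inner pb by blast
    next
      case False
      then show ?thesis using insert.prems(3) pb by (intro eliminate_inner_other[OF pb(1)]) auto
    qed
  qed (use insert.prems finite_eliminate in auto)
  then obtain K where K: "K \<ge> 0"
    "\<And>w w' z u. feasible (eliminate e S) w z \<Longrightarrow> feasible (eliminate e S) w' u \<Longrightarrow>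
           \<exists>z'. feasible (eliminate e S) w' z' \<and> norm (z - z') \<le> K * norm (w - w')"
    by blast
  have e: "e \<in> Basis" using insert.prems by auto
  \<comment> \<open>A violated row \<open>p\<close> is repaired by a shift along \<open>e\<close> of
    size violation over \<open>\<bar>fst p \<bullet> e\<bar>\<close>; the sum dominates all these
    ratios. Rows with zero \<open>e\<close>-component contribute 0, since division by zero gives
    0.\<close>
  define R where "R = (\<Sum>p\<in>S. (norm (snd p) + norm (fst p) * K) / \<bar>fst p \<bullet> e\<bar>)"
  have R_ge: "(norm (snd p) + norm (fst p) * K) / \<bar>fst p \<bullet> e\<bar> \<le> R" if "p \<in> S" for p
    unfolding R_def using that insert.prems K(1) by (intro member_le_sum) auto
  have R0: "R \<ge> 0" unfolding R_def using K(1) by (intro sum_nonneg) auto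
  have "\<exists>z'. feasible S w' z' \<and> norm (z - z') \<le> (K + R) * norm (w - w')"
    if z: "feasible S w z" and u: "feasible S w' u" for w w' z u
  proof -
    obtain z1 where z1: "feasible (eliminate e S) w' z1" "norm (z - z1) \<le> K * norm (w - w')"
      using K(2) feasible_eliminate z u by blast
    define M where "M = R * norm (w - w')"
    have M0: "M \<ge> 0" using R0 by (simp add: M_def)
    \<comment> \<open>The value of \<open>t\<close> at which row \<open>p\<close> is tight at
      \<open>z1 + t *\<^sub>R e\<close>: a lower bound on \<open>t\<close> for rows in
      \<open>A\<close>, an upper bound for rows in \<open>C\<close>.\<close>
    define s where "s p = (snd p \<bullet> w' - fst p \<bullet> z1) / (fst p \<bullet> e)" for p :: "'a \<times> 'b"
    define A where "A = {p \<in> S. fst p \<bullet> e < 0}"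
    define C where "C = {p \<in> S. fst p \<bullet> e > 0}"
    \<comment> \<open>Row \<open>p\<close> holds at \<open>z\<close> and \<open>w\<close>, so its
      violation at \<open>z1\<close> and \<open>w'\<close> stems only from the two
      displacements.\<close>
    have slack: "fst p \<bullet> z1 - snd p \<bullet> w' \<le> M * \<bar>fst p \<bullet> e\<bar>" if "p \<in> S" "fst p \<bullet> e \<noteq> 0" for p
    proof -
      have "fst p \<bullet> z1 - snd p \<bullet> w' \<le> fst p \<bullet> (z1 - z) + snd p \<bullet> (w - w')"
        using feasibleD[OF z that(1)] by (simp add: inner_diff_right)
      also have "\<dots> \<le> norm (fst p) * norm (z1 - z) + norm (snd p) * norm (w - w')"
        by (intro add_mono norm_cauchy_schwarz)
      also have "\<dots> \<le> norm (fst p) * (K * norm (w - w')) + norm (snd p) * norm (w - w')"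
        using z1(2) by (intro add_mono mult_left_mono) (auto simp: norm_minus_commute)
      also have "\<dots> = (norm (snd p) + norm (fst p) * K) * norm (w - w')"
        by (simp add: distrib_right)
      also have "\<dots> \<le> (R * \<bar>fst p \<bullet> e\<bar>) * norm (w - w')"
        using R_ge[OF that(1)] that(2) by (intro mult_right_mono) (auto simp: pos_divide_le_eq)
      finally show ?thesis by (simp add: M_def mult_ac)
    qed
    have "\<exists>t. \<bar>t\<bar> \<le> M \<and> (\<forall>a\<in>s ` A. a \<le> t) \<and> (\<forall>b\<in>s ` C. t \<le> b)"
    proof (rule exists_between_finite)
      show "finite (s ` A)" using insert.prems by (simp add: A_def)
    next
      fix a b assume "a \<in> s ` A" "b \<in> s ` C"
      \<comment> \<open>The eliminated row built from \<open>p\<close> and \<open>q\<close> says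
        exactly that the lower bound lies below the upper one.\<close>
      then obtain q p where pq: "q \<in> A" "a = s q" "p \<in> C" "b = s p" by auto
      then have "p /\<^sub>R (fst p \<bullet> e) - q /\<^sub>R (fst q \<bullet> e) \<in> eliminate e S"
        unfolding eliminate_def A_def C_def
        by (intro UnI2 image_eqI[where x = "(p, q)"]) auto
      from feasibleD[OF z1(1) this]
      have "(fst p \<bullet> z1) / (fst p \<bullet> e) - (fst q \<bullet> z1) / (fst q \<bullet> e)
          \<le> (snd p \<bullet> w') / (fst p \<bullet> e) - (snd q \<bullet> w') / (fst q \<bullet> e)"
        by (simp add: inner_diff_left divide_inverse mult.commute)
      then show "a \<le> b" by (simp add: pq(2,4) s_def diff_divide_distrib)
    next
      fix a assume "a \<in> s ` A"
      then obtain q where q: "q \<in> S" "fst q \<bullet> e < 0" "a = s q" by (auto simp: A_def)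
      then show "a \<le> M" using slack[of q] by (simp add: s_def neg_divide_le_eq)
    next
      fix b assume "b \<in> s ` C"
      then obtain q where q: "q \<in> S" "fst q \<bullet> e > 0" "b = s q" by (auto simp: C_def)
      then show "- M \<le> b" using slack[of q] by (simp add: s_def pos_le_divide_eq)
    qed (fact M0)
    then obtain t where t: "\<bar>t\<bar> \<le> M" "\<And>p. p \<in> A \<Longrightarrow> s p \<le> t" "\<And>p. p \<in> C \<Longrightarrow> t \<le> s p"
      by auto
    have "fst p \<bullet> (z1 + t *\<^sub>R e) \<le> snd p \<bullet> w'" if p: "p \<in> S" for p
    proof -
      consider "fst p \<bullet> e = 0" | "p \<in> A" | "p \<in> C" using p
        unfolding A_def C_def mem_Collect_eq by (metis linorder_less_linear)
      then show ?thesis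
      proof cases
        case 1
        with p have "p \<in> eliminate e S" by (simp add: eliminate_def)
        from feasibleD[OF z1(1) this] 1 show ?thesis by (simp add: inner_add_right)
      next
        case 2
        then show ?thesis using t(2)[OF 2]
          by (simp add: A_def s_def inner_add_right neg_divide_le_eq)
      next
        case 3
        then show ?thesis using t(3)[OF 3]
          by (simp add: C_def s_def inner_add_right pos_le_divide_eq)
      qed
    qed
    then have "feasible S w' (z1 + t *\<^sub>R e)" by (auto simp: feasible_def)
    moreover have "norm (z - (z1 + t *\<^sub>R e)) \<le> norm (z - z1) + norm (t *\<^sub>R e)"
      by (metis diff_diff_eq norm_triangle_ineq4)
    then have "norm (z - (z1 + t *\<^sub>R e)) \<le> (K + R) * norm (w - w')"
      using z1(2) t(1) e by (simp add: M_def algebra_simps)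
    ultimately show ?thesis by blast
  qed
  then show ?case using K(1) R0 by (intro exI[of _ "K + R"]) auto
qed

lemma feasible_lipschitz:
  fixes S :: "('a::euclidean_space \<times> 'b::euclidean_space) set"
  assumes "finite S"
  obtains K where "K \<ge> 0"
    and "\<And>w w' z u. feasible S w z \<Longrightarrow> feasible S w' u \<Longrightarrow>
           \<exists>z'. feasible S w' z' \<and> norm (z - z') \<le> K * norm (w - w')"
  using feasible_lipschitz_aux[of Basis S] assms that by (auto; metis)

lemma polyhedron_inner_constraints:
  fixes Z :: "'a::euclidean_space set"
  assumes "polyhedron Z"
  obtains H where "finite H" "Z = {z. \<forall>(a, b)\<in>H. a \<bullet> z \<le> b}"
proof -
  obtain F where F: "finite F" "Z = \<Inter>F" "\<forall>h\<in>F. \<exists>a b. a \<noteq> 0 \<and> h = {x. a \<bullet> x \<le> b}"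
    using assms by (auto simp: polyhedron_def)
  then obtain a b where "\<And>h. h \<in> F \<Longrightarrow> h = {x. a h \<bullet> x \<le> (b h :: real)}"
    by metis
  then have "Z = {z. \<forall>(a, b)\<in>(\<lambda>h. (a h, b h)) ` F. a \<bullet> z \<le> b}" using F(2) by fastforce
  then show ?thesis using F(1) that by blast
qed

text \<open>The representing vector is the adjoint of \<open>h\<close> applied to 1.\<close>

lemma linear_functional_inner:
  fixes h :: "'a::euclidean_space \<Rightarrow> real"
  assumes "linear h"
  obtains a where "\<And>x. h x = a \<bullet> x"
  using adjoint_works[OF assms, of _ 1] by (metis inner_commute inner_real_def mult.right_neutral)

section \<open>Lipschitz continuity of the recourse functions\<close>

lemma one_sided_lipschitz_imp_continuous_on:
  fixes f :: "'a::real_normed_vector \<Rightarrow> real"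
  assumes "\<And>x x'. x \<in> X \<Longrightarrow> x' \<in> X \<Longrightarrow> f x' \<le> f x + C * norm (x - x')"
  shows "continuous_on X f"
proof -
  \<comment> \<open>The sign of \<open>C\<close> is not assumed, whereas a Lipschitz constant must
    be nonnegative.\<close>
  have "\<bar>C\<bar>-lipschitz_on X f"
  proof (rule lipschitz_onI)
    fix x y assume "x \<in> X" "y \<in> X"
    then have "\<bar>f x - f y\<bar> \<le> C * norm (x - y)"
      using assms[of x y] assms[of y x] by (simp add: norm_minus_commute)
    also have "\<dots> \<le> \<bar>C\<bar> * norm (x - y)" by (intro mult_right_mono) auto
    finally show "dist (f x) (f y) \<le> \<bar>C\<bar> * dist x y" by (simp add: dist_norm)
  qed auto
  then show ?thesis by (rule lipschitz_on_continuous_on)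
qed

text \<open>It suffices to repair a solution \<open>(y, z)\<close> for \<open>x\<close> to a solution \<open>(y, z')\<close> for \<open>x'\<close>, keeping \<open>y\<close>.\<close>

lemma recourse_continuous_on:
  fixes f :: "real ^ 'n1 \<Rightarrow> real" and L :: "(real ^ 'n1) \<times> (real ^ 'n2) \<Rightarrow> real ^ 'm2"
  assumes min: "\<And>x. x \<in> X \<Longrightarrow> is_minimum (f x)
        {l (y + z) | y z. (\<forall>r. L (x, y + z) $ r \<le> 0) \<and> y \<in> Y \<inter> mixed_integer J \<and> z \<in> Z}"
    and l: "\<And>v v'. \<bar>l v - l v'\<bar> \<le> c * norm (v - v')" and "c \<ge> 0"
    and repair: "\<And>x x' y z. \<lbrakk>x \<in> X; x' \<in> X; y \<in> Y \<inter> mixed_integer J; z \<in> Z; \<forall>r. L (x, y + z) $ r \<le> 0\<rbrakk>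
       \<Longrightarrow> \<exists>z'\<in>Z. (\<forall>r. L (x', y + z') $ r \<le> 0) \<and> norm (z - z') \<le> K * norm (x - x')"
  shows "continuous_on X f"
proof (rule one_sided_lipschitz_imp_continuous_on)
  fix x x' assume x: "x \<in> X" "x' \<in> X"
  obtain y z where yz: "f x = l (y + z)" "\<forall>r. L (x, y + z) $ r \<le> 0" "y \<in> Y \<inter> mixed_integer J" "z \<in> Z"
    using min[OF x(1)] unfolding is_minimum_def by blast
  obtain z' where z': "z' \<in> Z" "\<forall>r. L (x', y + z') $ r \<le> 0" "norm (z - z') \<le> K * norm (x - x')"
    using repair[OF x yz(3,4,2)] by blast
  have "f x' \<le> l (y + z')" using min[OF x(2)] yz z' unfolding is_minimum_def by blast
  also have "\<dots> \<le> l (y + z) + c * norm (z - z')"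
    using l[of "y + z'" "y + z"] by (simp add: norm_minus_commute)
  also have "\<dots> \<le> f x + (c * K) * norm (x - x')"
    using z'(3) \<open>c \<ge> 0\<close> yz(1) by (simp add: mult.assoc mult_left_mono)
  finally show "f x' \<le> f x + (c * K) * norm (x - x')" .
qed

text \<open>The admissible \<open>z\<close> solve a linear system with fixed left-hand sides, whose
  right-hand sides are affine in \<open>(x, y)\<close>, so \<open>feasible_lipschitz\<close>
  applies.\<close>

lemma affine_recourse_repair:
  fixes L :: "(real ^ 'n1) \<times> (real ^ 'n2) \<Rightarrow> real ^ 'm2"
  assumes "affine_recourse X J l L Y Z"
  obtains K where
    "\<And>x x' y z. \<lbrakk>x \<in> X; x' \<in> X; y \<in> Y \<inter> mixed_integer J; z \<in> Z; \<forall>r. L (x, y + z) $ r \<le> 0\<rbrakk>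
       \<Longrightarrow> \<exists>z'\<in>Z. (\<forall>r. L (x', y + z') $ r \<le> 0) \<and> norm (z - z') \<le> K * norm (x - x')"
proof -
  obtain A b where A: "linear A" and L: "L = (\<lambda>p. A p + b)"
    using assms by (auto simp: affine_recourse_def affine_function_def)
  have "polyhedron Z" using assms by (simp add: affine_recourse_def)
  then obtain H where H: "finite H" "Z = {z. \<forall>(a, b)\<in>H. a \<bullet> z \<le> b}"
    by (rule polyhedron_inner_constraints)
  have "\<exists>c. \<forall>p. A p $ r = c \<bullet> p" for r
  proof -
    have "linear (\<lambda>p. A p $ r)"
      using linear_compose[OF A bounded_linear.linear[OF bounded_linear_vec_nth[of r]]]
      by (simp add: o_def)
    from linear_functional_inner[OF this] show ?thesis by metis
  qed
  then obtain c where c: "\<And>r p. A p $ r = c r \<bullet> p" by metis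
  \<comment> \<open>The parameter is \<open>((x, y), 1)\<close>: its last entry makes the constant terms linear, and for fixed
    \<open>y\<close> it moves by exactly \<open>x - x'\<close>, so the bound is uniform in \<open>y\<close>.\<close>
  define S :: "((real ^ 'n2) \<times> ((real ^ 'n1) \<times> (real ^ 'n2)) \<times> real) set" where
    "S = range (\<lambda>r. (snd (c r), (- c r, - b $ r))) \<union> (\<lambda>(a, b). (a, (0, b))) ` H"
  have "finite S" using H(1) by (simp add: S_def)
  then obtain K where K:
    "\<And>w w' z u. feasible S w z \<Longrightarrow> feasible S w' u \<Longrightarrow>
           \<exists>z'. feasible S w' z' \<and> norm (z - z') \<le> K * norm (w - w')"
    using feasible_lipschitz by metis
  have S: "feasible S ((x, y), 1) z \<longleftrightarrow> (\<forall>r. L (x, y + z) $ r \<le> 0) \<and> z \<in> Z" for x y z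
  proof -
    have row: "snd (c r) \<bullet> z \<le> (- c r, - b $ r) \<bullet> ((x, y), 1) \<longleftrightarrow> L (x, y + z) $ r \<le> 0" for r
      by (cases "c r") (auto simp: L c inner_add_right)
    show ?thesis unfolding feasible_def S_def H(2)
      by (simp add: ball_Un case_prod_beta flip: row)
  qed
  show ?thesis
  proof (rule that)
    fix x x' y z
    assume *: "x \<in> X" "x' \<in> X" "y \<in> Y \<inter> mixed_integer J" "z \<in> Z" "\<forall>r. L (x, y + z) $ r \<le> 0"
    \<comment> \<open>Complete recourse enters here: it makes the system at \<open>x'\<close>
      solvable.\<close>
    obtain u where "u \<in> Z" "\<forall>r. L (x', y + u) $ r \<le> 0"
      using assms * unfolding affine_recourse_def by blast
    then obtain z' where "feasible S ((x', y), 1) z'"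
      "norm (z - z') \<le> K * norm (((x, y), 1::real) - ((x', y), 1))"
      using K S * by meson
    then show "\<exists>z'\<in>Z. (\<forall>r. L (x', y + z') $ r \<le> 0) \<and> norm (z - z') \<le> K * norm (x - x')"
      using S by (auto simp: norm_Pair)
  qed
qed

text \<open>Passing from \<open>x\<close> to \<open>x'\<close> violates the constraints by at most
  \<open>\<eta>\<close>, while the Slater point \<open>u\<close> for \<open>x'\<close> has slack
  \<open>\<delta>\<close>. By convexity a step from \<open>z\<close> towards \<open>u\<close>
  absorbs the violation; its length is linear in \<open>\<eta>\<close> because \<open>Z\<close> is
  bounded.\<close>

lemma lipschitz_recourse_repair:
  fixes L :: "(real ^ 'n1) \<times> (real ^ 'n2) \<Rightarrow> real ^ 'm2"
  assumes "lipschitz_recourse X J l L Y Z" and Y: "Y \<subseteq> coord_space J" and Z: "Z \<subseteq> coord_space (- J)"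
  obtains K where
    "\<And>x x' y z. \<lbrakk>x \<in> X; x' \<in> X; y \<in> Y \<inter> mixed_integer J; z \<in> Z; \<forall>r. L (x, y + z) $ r \<le> 0\<rbrakk>
       \<Longrightarrow> \<exists>z'\<in>Z. (\<forall>r. L (x', y + z') $ r \<le> 0) \<and> norm (z - z') \<le> K * norm (x - x')"
proof -
  obtain C where C: "C-lipschitz_on UNIV L" using assms by (auto simp: lipschitz_recourse_def)
  have C0: "C \<ge> 0" using C by (rule lipschitz_on_nonneg)
  have conv: "convex_on (coord_space (- J)) (\<lambda>z. L (x, y + z) $ r)" if "y \<in> Y" for x y r
    using assms that by (auto simp: lipschitz_recourse_def)
  have "convex Z" "bounded Z"
    using assms by (auto simp: lipschitz_recourse_def compact_imp_bounded)
  obtain \<delta> where \<delta>: "\<delta> > 0"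
    "\<And>x y. x \<in> X \<Longrightarrow> y \<in> Y \<inter> mixed_integer J \<Longrightarrow> \<exists>z\<in>Z. \<forall>r. L (x, y + z) $ r < - \<delta>"
    using assms unfolding lipschitz_recourse_def by metis
  obtain D where D: "\<And>z z'. z \<in> Z \<Longrightarrow> z' \<in> Z \<Longrightarrow> norm (z - z') \<le> D"
    using \<open>bounded Z\<close> by (metis bounded_two_points dist_norm)
  show ?thesis
  proof (rule that)
    fix x x' y z
    assume *: "x \<in> X" "x' \<in> X" "y \<in> Y \<inter> mixed_integer J" "z \<in> Z" "\<forall>r. L (x, y + z) $ r \<le> 0"
    obtain u where u: "u \<in> Z" "\<And>r. L (x', y + u) $ r < - \<delta>" using \<delta>(2) * by blast
    define \<eta> where "\<eta> = C * norm (x - x')"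
    have \<eta>: "\<eta> \<ge> 0" using C0 by (simp add: \<eta>_def)
    \<comment> \<open>The weight that balances violation and slack exactly:
      \<open>(1 - s) * \<eta> = s * \<delta>\<close>.\<close>
    define s where "s = \<eta> / (\<eta> + \<delta>)"
    have s: "0 \<le> s" "s \<le> 1" "(1 - s) * \<eta> = s * \<delta>" "s \<le> \<eta> / \<delta>"
      using \<eta> \<delta>(1) by (auto simp: s_def field_simps)
    define z' where "z' = (1 - s) *\<^sub>R z + s *\<^sub>R u"
    have "z' \<in> Z" using \<open>convex Z\<close> * u s by (auto simp: z'_def intro: convexD)
    moreover have "L (x', y + z') $ r \<le> 0" for r
    proof -
      have "\<bar>(L (x', y + z) - L (x, y + z)) $ r\<bar> \<le> dist (L (x', y + z)) (L (x, y + z))"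
        unfolding dist_norm by (rule component_le_norm_cart)
      also have "\<dots> \<le> C * dist (x', y + z) (x, y + z)" using C by (rule lipschitz_onD) auto
      also have "\<dots> = \<eta>" by (simp add: \<eta>_def dist_Pair_Pair dist_norm norm_minus_commute)
      finally have "L (x', y + z) $ r \<le> \<eta>" using *(5)[rule_format, of r] by simp
      have "L (x', y + z') $ r \<le> (1 - s) * (L (x', y + z) $ r) + s * (L (x', y + u) $ r)"
        unfolding z'_def using convex_onD[OF conv] * u s Z by blast
      also have "\<dots> \<le> (1 - s) * \<eta> + s * (- \<delta>)"
        using s \<open>L (x', y + z) $ r \<le> \<eta>\<close> u(2)[of r] by (intro add_mono mult_left_mono) auto
      finally show ?thesis using s(3) by simp
    qed
    moreover have "norm (z - z') \<le> C / \<delta> * D * norm (x - x')"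
    proof -
      have "z - z' = s *\<^sub>R (z - u)" by (simp add: z'_def algebra_simps)
      then have "norm (z - z') = s * norm (z - u)" using s by simp
      also have "\<dots> \<le> \<eta> / \<delta> * D" using s D * u \<eta> \<delta>(1) by (intro mult_mono) auto
      finally show ?thesis by (simp add: \<eta>_def mult_ac)
    qed
    ultimately show "\<exists>z'\<in>Z. (\<forall>r. L (x', y + z') $ r \<le> 0) \<and> norm (z - z') \<le> C / \<delta> * D * norm (x - x')"
      by blast
  qed
qed

lemma complete_continuous_recourse_continuous_on:
  fixes f :: "real ^ 'n1 \<Rightarrow> real" and L :: "(real ^ 'n1) \<times> (real ^ 'n2) \<Rightarrow> real ^ 'm2"
  assumes "complete_continuous_recourse X J l L Y Z f"
  shows "continuous_on X f"
proof -
  have min: "\<And>x. x \<in> X \<Longrightarrow> is_minimum (f x)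
        {l (y + z) | y z. (\<forall>r. L (x, y + z) $ r \<le> 0) \<and> y \<in> Y \<inter> mixed_integer J \<and> z \<in> Z}"
    and YZ: "Y \<subseteq> coord_space J" "Z \<subseteq> coord_space (- J)"
    and cases: "affine_recourse X J l L Y Z \<or> lipschitz_recourse X J l L Y Z"
    using assms unfolding complete_continuous_recourse_def by blast+
  \<comment> \<open>The objective is Lipschitz in both cases; in the affine one because its linear
    part is bounded.\<close>
  obtain c where c: "c \<ge> 0" "\<And>v v'. \<bar>l v - l v'\<bar> \<le> c * norm (v - v')"
  proof (cases "affine_recourse X J l L Y Z")
    case True
    then obtain A b where A: "linear A" "l = (\<lambda>v. A v + b)"
      by (auto simp: affine_recourse_def affine_function_def)
    obtain B where B: "B > 0" "\<And>v. norm (A v) \<le> B * norm v"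
      using linear_bounded_pos[OF A(1)] by blast
    show ?thesis
    proof (rule that)
      show "\<bar>l v - l v'\<bar> \<le> B * norm (v - v')" for v v'
        using B(2)[of "v - v'"] by (simp add: A linear_diff)
    qed (use B in simp)
  next
    case False
    then obtain C where "C-lipschitz_on UNIV l" using cases by (auto simp: lipschitz_recourse_def)
    then show ?thesis
      using that[of C] by (force simp: lipschitz_on_def dist_norm)
  qed
  obtain K where
    "\<And>x x' y z. \<lbrakk>x \<in> X; x' \<in> X; y \<in> Y \<inter> mixed_integer J; z \<in> Z; \<forall>r. L (x, y + z) $ r \<le> 0\<rbrakk>
       \<Longrightarrow> \<exists>z'\<in>Z. (\<forall>r. L (x', y + z') $ r \<le> 0) \<and> norm (z - z') \<le> K * norm (x - x')"
    using cases affine_recourse_repair lipschitz_recourse_repair[OF _ YZ] by metis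
  then show ?thesis using recourse_continuous_on[OF min c(2,1)] by blast
qed

section \<open>Convergence of the lower bounds\<close>

text \<open>Otherwise infinitely many terms are at distance at least \<open>e\<close> from all
  earlier ones. They form an \<open>e\<close>-separated sequence, which has no Cauchy subsequence,
  against compactness.\<close>

lemma compact_eventually_close_to_earlier:
  fixes s :: "nat \<Rightarrow> 'a::metric_space"
  assumes "compact X" "\<And>t. s t \<in> X" "e > 0"
  shows "eventually (\<lambda>t. \<exists>t'<t. dist (s t) (s t') < e) sequentially"
proof (rule ccontr)
  define T where "T = {t. \<forall>t'<t. e \<le> dist (s t) (s t')}"
  assume "\<not> ?thesis"
  then have "\<exists>t\<ge>m. t \<in> T" for m
    unfolding T_def eventually_sequentially mem_Collect_eq by (meson not_less)
  then have "infinite T" by (auto simp: infinite_nat_iff_unbounded_le)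
  then have r: "strict_mono (enumerate T)" "\<And>n. enumerate T n \<in> T"
    by (auto simp: strict_mono_enumerate enumerate_in_set)
  obtain x k where "strict_mono k" "((s \<circ> enumerate T) \<circ> k) \<longlonglongrightarrow> x"
    using assms(1,2) unfolding compact_def by (metis comp_apply)
  then have "Cauchy ((s \<circ> enumerate T) \<circ> k)" by (simp add: LIMSEQ_imp_Cauchy)
  then obtain M where "dist (s (enumerate T (k (Suc M)))) (s (enumerate T (k M))) < e"
    using assms(3) unfolding Cauchy_def by (metis comp_apply le_refl lessI less_imp_le)
  moreover have "enumerate T (k M) < enumerate T (k (Suc M))"
    using r(1) \<open>strict_mono k\<close> by (simp add: strict_mono_less)
  ultimately show False using r(2)[of "k (Suc M)"] by (force simp: T_def)
qed

lemma mem_centers: "t' < t \<Longrightarrow> i \<in> {1..N} \<Longrightarrow> xs t' i \<in> centers N xs t"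
  by (induction t) (auto simp: less_Suc_eq)

lemma centers_subset: "(\<And>t i. i \<in> {1..N} \<Longrightarrow> xs t i \<in> X) \<Longrightarrow> centers N xs t \<subseteq> X"
  by (induction t) auto

lemma finite_centers: "finite (centers N xs t)"
  by (induction t) auto

text \<open>Only the cell containing \<open>x\<close> contributes to the sum. The same center
  \<open>c\<close> serves every \<open>i\<close>, so that \<open>sum_g_star\<close> applies at
  \<open>x\<close>.\<close>

lemma voronoi_regularizer:
  assumes "voronoi_partition X C P" "finite C" "x \<in> X"
  obtains c where "c \<in> C" "\<And>c'. c' \<in> C \<Longrightarrow> norm (x - c) \<le> norm (x - c')"
    and "\<And>i. pw_const_regularizer N f C P i x = g_star N f i c"
proof -
  obtain c where c: "c \<in> C" "x \<in> P c" using assms unfolding voronoi_partition_def by blast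
  have "x \<notin> P c'" if "c' \<in> C" "c' \<noteq> c" for c'
    using assms(1) c that unfolding voronoi_partition_def disjoint_family_on_def by blast
  then have "pw_const_regularizer N f C P i x = (\<Sum>c'\<in>C. if c' = c then g_star N f i c' else 0)" for i
    unfolding pw_const_regularizer_def using c by (intro sum.cong) auto
  then have "pw_const_regularizer N f C P i x = g_star N f i c" for i
    using c(1) assms(2) by simp
  moreover have "norm (x - c) \<le> norm (x - c')" if "c' \<in> C" for c'
    using assms(1) c that unfolding voronoi_partition_def by blast
  ultimately show ?thesis using c(1) that by blast
qed

lemma sum_g_star:
  assumes "N \<ge> 1"
  shows "(\<Sum>i=1..N. g_star N f i x) = 0"
  using assms by (simp add: g_star_def sum_subtractf)

lemma gdd_value_le_lb: "gdd_value N f g xs t \<le> gdd_lb N f g xs t"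
  by (cases t) auto

lemma gdd_lb_le: "(\<And>t. gdd_value N f g xs t \<le> v) \<Longrightarrow> gdd_lb N f g xs t \<le> v"
  by (induction t) auto

theorem theorem3:
  fixes N :: nat
    and X :: "(real ^ 'n1) set" and I :: "'n1 set"
    and f :: "nat \<Rightarrow> real ^ 'n1 \<Rightarrow> real"
    and J :: "'n2::finite set"
    and l :: "nat \<Rightarrow> real ^ 'n2 \<Rightarrow> real"
    and L :: "nat \<Rightarrow> (real ^ 'n1) \<times> (real ^ 'n2) \<Rightarrow> real ^ 'm2"
    and Y Z :: "nat \<Rightarrow> (real ^ 'n2) set"
    and g :: "nat \<Rightarrow> nat \<Rightarrow> real ^ 'n1 \<Rightarrow> real"
    and xs :: "nat \<Rightarrow> nat \<Rightarrow> real ^ 'n1"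
    and P :: "nat \<Rightarrow> real ^ 'n1 \<Rightarrow> (real ^ 'n1) set"
  assumes "N \<ge> 1"
    and "X \<subseteq> mixed_integer I" and "X \<noteq> {}" and "compact X"
    and "\<And>i. i \<in> {1..N} \<Longrightarrow>
           complete_continuous_recourse X J (l i) (L i) (Y i) (Z i) (f i)"
    and "gdd_run N X f g xs"
    and "\<And>t. t \<ge> 1 \<Longrightarrow> voronoi_partition X (centers N xs t) (P t)"
    and "\<And>t i x. t \<ge> 1 \<Longrightarrow> i \<in> {1..N} \<Longrightarrow> x \<in> X \<Longrightarrow>
           g t i x = pw_const_regularizer N f (centers N xs t) (P t) i x"
  shows "\<exists>v. is_minimum v ((\<lambda>x. \<Sum>i=1..N. f i x) ` X) \<and> gdd_lb N f g xs \<longlonglongrightarrow> v"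
proof -
  let ?F = "\<lambda>x. \<Sum>i=1..N. f i x"
  note N = assms(1) and vor = assms(7) and reg = assms(8)
  have cont: "continuous_on X (f i)" if "i \<in> {1..N}" for i
    using assms(5)[OF that] by (rule complete_continuous_recourse_continuous_on)
  then have "continuous_on X ?F" by (intro continuous_on_sum) auto
  then obtain x0 where x0: "x0 \<in> X" "\<And>x. x \<in> X \<Longrightarrow> ?F x0 \<le> ?F x"
    using continuous_attains_inf[OF assms(4,3)] by blast
  have xs: "xs t i \<in> X" and opt: "\<And>x. x \<in> X \<Longrightarrow> f i (xs t i) + g t i (xs t i) \<le> f i x + g t i x"
    if "i \<in> {1..N}" for t i
    using assms(6) that unfolding gdd_run_def is_arg_min_def by (auto simp: not_less)
  \<comment> \<open>Iteration 0 has no centers and is covered by the initialization to zero.\<close>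
  have g_sum: "(\<Sum>i=1..N. g t i x0) = 0" for t
  proof (cases "t = 0")
    case True
    then show ?thesis using assms(6) x0(1) by (simp add: gdd_run_def)
  next
    case False
    then have t: "t \<ge> 1" by simp
    obtain c where "\<And>i. pw_const_regularizer N f (centers N xs t) (P t) i x0 = g_star N f i c"
      using voronoi_regularizer[OF vor[OF t] finite_centers x0(1)] by metis
    then show ?thesis using reg[OF t _ x0(1)] sum_g_star[OF N, of f c] by simp
  qed
  have upper: "gdd_value N f g xs t \<le> ?F x0" for t
  proof -
    have "gdd_value N f g xs t \<le> (\<Sum>i=1..N. f i x0 + g t i x0)"
      unfolding gdd_value_def using opt x0(1) by (intro sum_mono) auto
    then show ?thesis using g_sum[of t] by (simp add: sum.distrib)
  qed
  have lower: "eventually (\<lambda>t. ?F x0 - e < gdd_value N f g xs t) sequentially" if "e > 0" for e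
  proof -
    \<comment> \<open>The \<open>N\<close> component errors then add up to \<open>e / 2\<close>,
      which leaves room for the strict inequality.\<close>
    define e' where "e' = e / (2 * real N)"
    have e': "e' > 0" using that N by (simp add: e'_def)
    have "eventually (\<lambda>t. ?F x0 / N - e' \<le> f i (xs t i) + g t i (xs t i)) sequentially"
      if i: "i \<in> {1..N}" for i
    proof -
      have "uniformly_continuous_on X (f i)"
        using cont[OF i] assms(4) by (rule compact_uniformly_continuous)
      then obtain d where d: "d > 0"
        "\<And>x c. x \<in> X \<Longrightarrow> c \<in> X \<Longrightarrow> dist x c < d \<Longrightarrow> dist (f i x) (f i c) < e'"
        using e' unfolding uniformly_continuous_on_def by (metis dist_commute)
      show ?thesis
        using compact_eventually_close_to_earlier[of X "\<lambda>t. xs t i", OF assms(4) xs[OF i] d(1)] eventually_ge_at_top[of 1]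
      proof eventually_elim
        case (elim t)
        obtain t' where t': "t' < t" "dist (xs t i) (xs t' i) < d" using elim by blast
        obtain c where c: "c \<in> centers N xs t"
          "\<And>c'. c' \<in> centers N xs t \<Longrightarrow> norm (xs t i - c) \<le> norm (xs t i - c')"
          "\<And>j. pw_const_regularizer N f (centers N xs t) (P t) j (xs t i) = g_star N f j c"
          using voronoi_regularizer[OF vor[OF elim(2)] finite_centers xs[OF i]] by metis
        have "c \<in> X" using c(1) centers_subset xs by blast
        \<comment> \<open>The earlier minimizer \<open>xs t' i\<close> is itself a center, and
          \<open>c\<close> is at least as close.\<close>
        have "dist (xs t i) c < d"
          using c(2)[OF mem_centers[OF t'(1) i]] t'(2) by (simp add: dist_norm)
        then have "f i c - f i (xs t i) < e'"
          using d(2)[OF xs[OF i, of t] \<open>c \<in> X\<close>] by (simp add: dist_real_def)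
        \<comment> \<open>The regularized value equals
          \<open>?F c / N - (f i c - f i (xs t i))\<close>.\<close>
        moreover have "?F x0 / N \<le> ?F c / N" using x0(2)[OF \<open>c \<in> X\<close>] by (intro divide_right_mono) auto
        ultimately show ?case using reg[OF elim(2) i xs[OF i]] c(3)[of i] by (simp add: g_star_def)
      qed
    qed
    then have "eventually (\<lambda>t. \<forall>i\<in>{1..N}. ?F x0 / N - e' \<le> f i (xs t i) + g t i (xs t i)) sequentially"
      by (simp add: eventually_ball_finite_distrib)
    then show ?thesis
    proof eventually_elim
      case (elim t)
      have "(\<Sum>i=1..N. ?F x0 / N - e') \<le> gdd_value N f g xs t"
        unfolding gdd_value_def using elim by (intro sum_mono) auto
      moreover have "(\<Sum>i=1..N. ?F x0 / N - e') = ?F x0 - e / 2"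
        using N by (simp add: e'_def right_diff_distrib)
      ultimately show ?case using that by linarith
    qed
  qed
  \<comment> \<open>The bound \<open>gdd_lb\<close> is squeezed between \<open>gdd_value\<close> at
    the same iteration and \<open>?F x0\<close>.\<close>
  have "gdd_lb N f g xs \<longlonglongrightarrow> ?F x0"
  proof (rule order_tendstoI)
    fix a assume "a < ?F x0"
    then have "eventually (\<lambda>t. a < gdd_value N f g xs t) sequentially"
      using lower[of "?F x0 - a"] by simp
    then show "eventually (\<lambda>t. a < gdd_lb N f g xs t) sequentially"
      by eventually_elim (use gdd_value_le_lb less_le_trans in blast)
  next
    fix a assume "?F x0 < a"
    then show "eventually (\<lambda>t. gdd_lb N f g xs t < a) sequentially"
      using gdd_lb_le[OF upper] by (intro always_eventually) (auto intro: le_less_trans)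
  qed
  moreover have "is_minimum (?F x0) (?F ` X)"
    using x0 by (auto simp: is_minimum_def)
  ultimately show ?thesis by blast
qed

end
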